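(* Let $K\subset\mathbb{R}^2$ be the Sierpiński gasket with intrinsic metric $d^K$, and let $D_n$ ($n=0,1,2,\dots$) be its Cantor-type approximations with geodesic metrics $d^D_n$ (as defined in the context). Then for all $a,b\in K$ and arbitrary sequences $a_n\in D_n$, $b_n\in D_n$ with $a_n\to a$ and $b_n\to b$ in the Euclidean metric, one has $$d^D_n(a_n,b_n)\to d^K(a,b)\quad\text{as } n\to\infty.$$
   Context: Let $O_1=(-\tfrac12,0)$, $O_2=(\tfrac12,0)$, $O_3=(0,\tfrac{\sqrt3}{2})$ in $\mathbb{R}^2$ and $F_i(y)=\tfrac12(y-O_i)+O_i$ for $i=1,2,3$. The Sierpiński gasket $K$ is the unique nonempty compact set with $K=F_1(K)\cup F_2(K)\cup F_3(K)$. The Cantor-type approximation is $D_0=$ the closed (filled) triangle which is the convex hull of $\{O_1,O_2,O_3\}$, and $D_{n+1}=F_1(D_n)\cup F_2(D_n)\cup F_3(D_n)$. The metrics $d^K$ and $d^D_n$ are the intrinsic metrics on $K$ and $D_n$: the infimum of Euclidean lengths of curves joining two points inside the set. *)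

theory Defs
  imports "HOL-Analysis.Analysis"
begin

definition gasket_O1 :: "real^2" where "gasket_O1 = vector [- 1/2, 0]"
definition gasket_O2 :: "real^2" where "gasket_O2 = vector [1/2, 0]"
definition gasket_O3 :: "real^2" where "gasket_O3 = vector [0, sqrt 3 / 2]"

definition half_contraction :: "real^2 \<Rightarrow> real^2 \<Rightarrow> real^2" where
  "half_contraction p y = (1/2) *\<^sub>R (y - p) + p"

definition gasket_step :: "(real^2) set \<Rightarrow> (real^2) set" where
  "gasket_step A = half_contraction gasket_O1 ` A \<union> half_contraction gasket_O2 ` A
                   \<union> half_contraction gasket_O3 ` A"

text \<open>Existence and uniqueness of the set described here (Hutchinson's theorem) are not
  built into the definition; they have to be proved before the description can be used.\<close>
definition sierpinski_gasket :: "(real^2) set" where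
  "sierpinski_gasket = (THE K. K \<noteq> {} \<and> compact K \<and> K = gasket_step K)"

primrec cantor_approx :: "nat \<Rightarrow> (real^2) set" where
  "cantor_approx 0 = convex hull {gasket_O1, gasket_O2, gasket_O3}"
| "cantor_approx (Suc n) = gasket_step (cantor_approx n)"

text \<open>The length is the supremum over all partitions \<open>0 = t 0 \<le> \<dots> \<le> t n = 1\<close> of the lengths of
  the inscribed polygonal lines; only the values of \<open>t\<close> on \<open>{..n}\<close> matter. It is \<open>\<infinity>\<close> for
  non-rectifiable curves.\<close>
definition curve_length :: "(real \<Rightarrow> 'a::metric_space) \<Rightarrow> ennreal" where
  "curve_length g =
     (SUP (n, t) \<in> {(n::nat, t::nat \<Rightarrow> real). mono_on {..n} t \<and> t 0 = 0 \<and> t n = 1}.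
        ennreal (\<Sum>i<n. dist (g (t i)) (g (t (Suc i)))))"

text \<open>The value is \<open>\<infinity>\<close> exactly when no rectifiable curve in \<open>S\<close> joins the two points.\<close>
definition intrinsic_dist :: "'a::metric_space set \<Rightarrow> 'a \<Rightarrow> 'a \<Rightarrow> ennreal" where
  "intrinsic_dist S x y =
     (INF g \<in> {g. path g \<and> path_image g \<subseteq> S \<and> pathstart g = x \<and> pathfinish g = y}.
        curve_length g)"

end

theory Submission
  imports Defs "HOL-Complex_Analysis.Great_Picard"
begin

text \<open>Points at intrinsic distance less than \<open>L\<close> are joined by a 1-Lipschitz curve on \<open>[0, L]\<close>.
  Since the approximations \<open>D n\<close> decrease to the gasket, the lower bound follows from Arzela-Ascoli:
  such curves in the \<open>D n\<close> subconverge to one in the gasket. For the upper bound it suffices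
  that short Euclidean distances are short in \<open>D n\<close> uniformly in \<open>n\<close>. By self-similarity, \<open>x\<close> is
  joined in \<open>D n\<close> to a vertex \<open>p\<close> within \<open>1 -\<close> (barycentric coordinate of \<open>x\<close> at \<open>p\<close>); two points in
  different cells are joined through the common vertex of these cells, and two points in the
  same cell by induction on \<open>n\<close>.\<close>

section \<open>Curves of bounded length as 1-Lipschitz curves\<close>

text \<open>\<open>L\<close> only bounds the length from above, since \<open>h\<close> may pause.
  The common domain \<open>{0..L}\<close> makes such curves equicontinuous, and the 1-Lipschitz
  condition survives pointwise limits.\<close>

definition joined_within :: "'a::metric_space set \<Rightarrow> real \<Rightarrow> 'a \<Rightarrow> 'a \<Rightarrow> bool" where
  "joined_within S L x y \<longleftrightarrow>
     0 \<le> L \<and> (\<exists>h. 1-lipschitz_on {0..L} h \<and> h ` {0..L} \<subseteq> S \<and> h 0 = x \<and> h L = y)"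

text \<open>Parametrization by arc length through a generalized inverse of the length function; the
  curve rests at its endpoint for parameters beyond its length.\<close>

lemma lipschitz_reparametrization:
  fixes g :: "real \<Rightarrow> 'a::metric_space"
  assumes "path g" and L: "0 \<le> L" and len: "curve_length g \<le> ennreal L"
  obtains h where "1-lipschitz_on {0..L} h" "h ` {0..L} \<subseteq> path_image g"
    "h 0 = pathstart g" "h L = pathfinish g"
proof -
  have cont: "continuous_on {0..1} g"
    using \<open>path g\<close> by (simp add: path_def)
  \<comment> \<open>\<open>P t\<close> collects the lengths of polygons inscribed in
    \<open>g\<close> up to time \<open>t\<close>; for \<open>t\<close> in \<open>{0..1}\<close> its
    supremum is the arc length up to \<open>t\<close>.\<close>
  define P where "P t = {\<Sum>i<n. dist (g (\<tau> i)) (g (\<tau> (Suc i))) | n \<tau>.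
    mono_on {..n} \<tau> \<and> \<tau> 0 = 0 \<and> \<tau> n = t}" for t :: real
  have zero: "0 \<in> P 0"
    unfolding P_def by (intro CollectI exI[of _ 0] exI[of _ "\<lambda>_. 0"]) (auto simp: mono_on_def)
  have step: "c + dist (g t) (g t') \<in> P t'" if "c \<in> P t" "t \<le> t'" for c t t'
  proof -
    obtain n \<tau> where c: "c = (\<Sum>i<n. dist (g (\<tau> i)) (g (\<tau> (Suc i))))"
      and \<tau>: "mono_on {..n} \<tau>" "\<tau> 0 = 0" "\<tau> n = t"
      using \<open>c \<in> P t\<close> by (auto simp: P_def)
    \<comment> \<open>The default beyond \<open>n\<close> appends \<open>t'\<close> as the last
      partition point.\<close>
    define \<sigma> where "\<sigma> i = (if i \<le> n then \<tau> i else t')" for i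
    have "\<tau> i \<le> t'" if "i \<le> n" for i
      using mono_onD[OF \<tau>(1), of i n] that \<open>t \<le> t'\<close> \<tau>(3) by auto
    then have "mono_on {..Suc n} \<sigma>"
      using \<tau>(1) by (auto simp: mono_on_def \<sigma>_def)
    moreover have "(\<Sum>i<Suc n. dist (g (\<sigma> i)) (g (\<sigma> (Suc i)))) = c + dist (g t) (g t')"
      unfolding c by (auto simp: \<sigma>_def \<tau> intro!: sum.cong)
    moreover have "\<sigma> 0 = 0" "\<sigma> (Suc n) = t'"
      using \<tau> by (auto simp: \<sigma>_def)
    ultimately show ?thesis
      unfolding P_def by (intro CollectI exI[of _ "Suc n"] exI[of _ \<sigma>]) auto
  qed
  have P1: "c \<le> L" if "c \<in> P 1" for c
  proof -
    obtain n \<tau> where c: "c = (\<Sum>i<n. dist (g (\<tau> i)) (g (\<tau> (Suc i))))"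
      and \<tau>: "mono_on {..n} \<tau>" "\<tau> 0 = 0" "\<tau> n = 1"
      using \<open>c \<in> P 1\<close> by (auto simp: P_def)
    have "ennreal c \<le> curve_length g"
      unfolding curve_length_def c by (rule SUP_upper2[of "(n, \<tau>)"]) (use \<tau> in auto)
    with len have "ennreal c \<le> ennreal L"
      by (rule order_trans[rotated])
    then show ?thesis
      using L by simp
  qed
  \<comment> \<open>\<open>T u\<close> is the last time at which the length travelled so far is at most \<open>u\<close>. Chords between times
    strictly inside \<open>(T u, T v)\<close> have length at most \<open>v - u\<close>, so continuity of \<open>g\<close> suffices and
    that of its arc length is not needed.\<close>
  define A where "A u = {t \<in> {0..1}. \<forall>c \<in> P t. c \<le> u}" for u
  define T where "T u = Sup (A u)" for u
  have P0: "c = 0" if "c \<in> P 0" for c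
  proof -
    obtain n \<tau> where c: "c = (\<Sum>i<n. dist (g (\<tau> i)) (g (\<tau> (Suc i))))"
      and \<tau>: "mono_on {..n} \<tau>" "\<tau> 0 = 0" "\<tau> n = 0"
      using \<open>c \<in> P 0\<close> by (auto simp: P_def)
    have "\<tau> i = 0" if "i \<le> n" for i
      using mono_onD[OF \<tau>(1), of i n] mono_onD[OF \<tau>(1), of 0 i] that \<tau> by auto
    then show ?thesis
      unfolding c by (intro sum.neutral) auto
  qed
  have A0: "0 \<in> A u" if "0 \<le> u" for u
    using that P0 by (auto simp: A_def)
  have bdd: "bdd_above (A u)" for u
    by (rule bdd_aboveI[of _ 1]) (auto simp: A_def)
  have T_cl: "T u \<in> closure (A u)" if "0 \<le> u" for u
    unfolding T_def using A0[OF that] bdd by (intro closure_contains_Sup) auto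
  have cl_sub: "closure (A u) \<subseteq> {0..1}" for u
    by (rule closure_minimal) (auto simp: A_def)
  have T01: "T u \<in> {0..1}" if "0 \<le> u" for u
    using T_cl[OF that] cl_sub by blast
  have gap: "dist (g t) (g t') \<le> v - u"
    if "0 \<le> u" "0 \<le> v" "T u < t" "t \<le> t'" "t' < T v" for u v t t'
  proof -
    \<comment> \<open>As \<open>t\<close> lies beyond \<open>T u\<close>, some polygon up to
      \<open>t\<close> is longer than \<open>u\<close>. Extended by the chords to \<open>t'\<close>
      and on to \<open>t''\<close>, it still has length at most \<open>v\<close>.\<close>
    obtain t'' where t'': "t'' \<in> A v" "t' < t''"
      using \<open>t' < T v\<close> less_cSup_iff[OF _ bdd] A0[OF \<open>0 \<le> v\<close>] unfolding T_def by blast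
    have "t \<notin> A u"
      using cSup_upper[OF _ bdd] \<open>T u < t\<close> unfolding T_def by force
    moreover have "t \<in> {0..1}"
      using T01[of u] T01[of v] that by auto
    ultimately obtain c where c: "c \<in> P t" "u < c"
      by (auto simp: A_def not_le)
    have "(c + dist (g t) (g t')) + dist (g t') (g t'') \<in> P t''"
      using c t'' that by (intro step) auto
    then have "(c + dist (g t) (g t')) + dist (g t') (g t'') \<le> v"
      using t'' by (auto simp: A_def)
    then show ?thesis
      using c zero_le_dist[of "g t'" "g t''"] by linarith
  qed
  have lip: "dist (g (T u)) (g (T v)) \<le> v - u" if "0 \<le> u" "u \<le> v" for u v
  proof (cases "T u < T v")
    case True
    \<comment> \<open>Since \<open>gap\<close> covers only times strictly between \<open>T u\<close>
      and \<open>T v\<close>, the chord from \<open>m - s * d\<close> to \<open>m + s * d\<close> is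
      followed as \<open>s\<close> tends to 1.\<close>
    define m where "m = (T u + T v) / 2"
    define d where "d = (T v - T u) / 2"
    have d: "d > 0" "m - d = T u" "m + d = T v"
      using True by (auto simp: m_def d_def field_simps)
    have b: "0 \<le> T u" "T v \<le> 1"
      using T01[of u] T01[of v] that by auto
    have sd: "0 \<le> s * d \<and> s * d \<le> d" if "s \<in> {0..1}" for s
      using d that mult_right_mono[of s 1 d] by auto
    have "continuous_on {0..1} (\<lambda>s. dist (g (m - s * d)) (g (m + s * d)))"
    proof (intro continuous_on_dist continuous_on_compose2[OF cont] continuous_intros)
      have "m - s * d \<in> {0..1} \<and> m + s * d \<in> {0..1}" if "s \<in> {0..1}" for s
        using sd[OF that] d b
        by (smt (verit) atLeastAtMost_iff)
      then show "(\<lambda>s. m - s * d) ` {0..1} \<subseteq> {0..1}" "(\<lambda>s. m + s * d) ` {0..1} \<subseteq> {0..1}"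
        by blast+
    qed
    then have "continuous_on (closure {0<..<1}) (\<lambda>s. dist (g (m - s * d)) (g (m + s * d)))"
      by simp
    moreover have "dist (g (m - s * d)) (g (m + s * d)) \<le> v - u" if "s \<in> {0<..<1}" for s
    proof (rule gap)
      have "s * d < d" "0 \<le> s * d"
        using d that mult_strict_right_mono[of s 1 d] by auto
      then show "T u < m - s * d" "m - s * d \<le> m + s * d" "m + s * d < T v"
        using d by linarith+
    qed (use \<open>0 \<le> u\<close> \<open>u \<le> v\<close> in auto)
    ultimately have "dist (g (m - 1 * d)) (g (m + 1 * d)) \<le> v - u"
      using continuous_le_on_closure[of "{0<..<1}" "\<lambda>s. dist (g (m - s * d)) (g (m + s * d))" 1 "v - u"]
      by simp
    then show ?thesis
      using d by simp
  next
    case False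
    have "A u \<subseteq> A v"
      using that by (force simp: A_def)
    then have "T u \<le> T v"
      unfolding T_def using A0[OF \<open>0 \<le> u\<close>] bdd by (intro cSup_subset_mono) auto
    with False that show ?thesis
      by simp
  qed
  show ?thesis
  proof
    show "1-lipschitz_on {0..L} (\<lambda>u. g (T u))"
      by (rule lipschitz_on_leI) (use lip in \<open>auto simp: dist_real_def\<close>)
    show "(\<lambda>u. g (T u)) ` {0..L} \<subseteq> path_image g"
      using T01 by (auto simp: path_image_def)
    \<comment> \<open>\<open>T 0\<close> is positive if \<open>g\<close> starts with a pause;
      continuity carries the value \<open>g 0\<close> from \<open>A 0\<close> to its
      supremum.\<close>
    have "g t = g 0" if "t \<in> A 0" for t
      using step[OF zero, of t] that by (force simp: A_def)
    moreover have "continuous_on (closure (A 0)) g"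
      using cont cl_sub by (rule continuous_on_subset)
    ultimately show "g (T 0) = pathstart g"
      using continuous_constant_on_closure[of "A 0" g "g 0" "T 0"] T_cl[of 0]
      by (simp add: pathstart_def)
    have "1 \<in> A L"
      using P1 by (auto simp: A_def)
    then have "1 \<le> T L"
      unfolding T_def by (intro cSup_upper bdd)
    then show "g (T L) = pathfinish g"
      using T01[OF L] by (simp add: pathfinish_def)
  qed
qed

text \<open>Rescaled to \<open>{0..1}\<close> the curve is \<open>L\<close>-Lipschitz, so the length
  of an inscribed polygon is bounded by a sum telescoping to \<open>L\<close>.\<close>

lemma intrinsic_dist_le:
  assumes "joined_within S L x y"
  shows "intrinsic_dist S x y \<le> ennreal L"
proof -
  obtain h where L: "0 \<le> L" and h: "1-lipschitz_on {0..L} h" "h ` {0..L} \<subseteq> S" "h 0 = x" "h L = y"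
    using assms by (auto simp: joined_within_def)
  define g where "g t = h (L * t)" for t
  have sub: "(\<lambda>t. L * t) ` {0..1} \<subseteq> {0..L}"
    using L by (auto intro: mult_left_le)
  have "continuous_on {0..1} g"
    unfolding g_def
    by (intro continuous_on_compose2[OF lipschitz_on_continuous_on[OF h(1)] _ sub] continuous_intros)
  then have "path g" "path_image g \<subseteq> S" "pathstart g = x" "pathfinish g = y"
    using sub h by (auto simp: path_def path_image_def g_def pathstart_def pathfinish_def)
  then have "intrinsic_dist S x y \<le> curve_length g"
    unfolding intrinsic_dist_def by (intro INF_lower) auto
  also have "\<dots> \<le> ennreal L"
    unfolding curve_length_def
  proof (rule SUP_least, clarify)
    fix n :: nat and t :: "nat \<Rightarrow> real"
    assume t: "mono_on {..n} t" "t 0 = 0" "t n = 1"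
    have "(\<Sum>i<n. dist (g (t i)) (g (t (Suc i)))) \<le> (\<Sum>i<n. L * (t (Suc i) - t i))"
    proof (rule sum_mono)
      fix i assume "i \<in> {..<n}"
      then have le: "0 \<le> t i" "t i \<le> t (Suc i)" "t (Suc i) \<le> 1"
        using mono_onD[OF t(1), of 0 i] mono_onD[OF t(1), of i "Suc i"]
          mono_onD[OF t(1), of "Suc i" n] t by auto
      have "dist (g (t i)) (g (t (Suc i))) \<le> 1 * dist (L * t i) (L * t (Suc i))"
        unfolding g_def using le by (intro lipschitz_onD[OF h(1)] subsetD[OF sub] imageI) auto
      also have "\<dots> = L * (t (Suc i) - t i)"
        using le L by (simp add: dist_real_def abs_mult flip: right_diff_distrib)
      finally show "dist (g (t i)) (g (t (Suc i))) \<le> L * (t (Suc i) - t i)" .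
    qed
    also have "\<dots> = L"
      using t by (simp add: sum_lessThan_telescope flip: sum_distrib_left)
    finally show "ennreal (\<Sum>i<n. dist (g (t i)) (g (t (Suc i)))) \<le> ennreal L"
      by (rule ennreal_leI)
  qed
  finally show ?thesis .
qed

text \<open>The strict inequality yields an actual curve of length below \<open>L\<close> without a
  minimizer of the infimum.\<close>

lemma joined_within_if_intrinsic_dist_less:
  assumes "intrinsic_dist S x y < ennreal L"
  shows "joined_within S L x y"
proof -
  obtain g where g: "path g" "path_image g \<subseteq> S" "pathstart g = x" "pathfinish g = y"
    and len: "curve_length g < ennreal L"
    using assms unfolding intrinsic_dist_def INF_less_iff by auto
  \<comment> \<open>\<open>ennreal\<close> sends negative reals to 0, and no length is below
    0.\<close>
  have L: "0 \<le> L"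
    using len ennreal_neg[of L] by (cases "0 \<le> L") auto
  obtain h where "1-lipschitz_on {0..L} h" "h ` {0..L} \<subseteq> path_image g"
    "h 0 = pathstart g" "h L = pathfinish g"
    using lipschitz_reparametrization[OF g(1) L less_imp_le[OF len]] .
  then show ?thesis
    unfolding joined_within_def using g L by (intro conjI exI[of _ h]) auto
qed

section \<open>Concatenation, reversal, segments and scaling of curves\<close>

lemma joined_within_mono:
  assumes "joined_within S L x y" "S \<subseteq> S'"
  shows "joined_within S' L x y"
  using assms unfolding joined_within_def by blast

lemma joined_within_trans:
  assumes "joined_within S L x y" "joined_within S M y z"
  shows "joined_within S (L + M) x z"
proof -
  obtain f where L: "0 \<le> L" and f: "1-lipschitz_on {0..L} f" "f ` {0..L} \<subseteq> S" "f 0 = x" "f L = y"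
    using assms by (auto simp: joined_within_def)
  obtain g where M: "0 \<le> M" and g: "1-lipschitz_on {0..M} g" "g ` {0..M} \<subseteq> S" "g 0 = y" "g M = z"
    using assms by (auto simp: joined_within_def)
  have g': "1-lipschitz_on {L..L + M} (\<lambda>u. g (u - L))"
  proof (rule lipschitz_onI)
    fix u v assume "u \<in> {L..L + M}" "v \<in> {L..L + M}"
    then show "dist (g (u - L)) (g (v - L)) \<le> 1 * dist u v"
      using lipschitz_onD[OF g(1), of "u - L" "v - L"] by (simp add: dist_real_def)
  qed simp
  define h where "h u = (if u \<le> L then f u else g (u - L))" for u
  have "1-lipschitz_on {0..L + M} h"
    unfolding h_def by (rule lipschitz_on_concat[OF f(1) g']) (use f g in auto)
  moreover have "h ` {0..L + M} \<subseteq> S"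
    using image_subset_iff[THEN iffD1, OF f(2)] image_subset_iff[THEN iffD1, OF g(2)]
    by (simp add: h_def image_subset_iff)
  moreover have "h 0 = x" "h (L + M) = z"
    using f g L M by (auto simp: h_def)
  ultimately show ?thesis
    using L M by (auto simp: joined_within_def)
qed

lemma joined_within_sym:
  assumes "joined_within S L x y"
  shows "joined_within S L y x"
proof -
  obtain h where L: "0 \<le> L" and h: "1-lipschitz_on {0..L} h" "h ` {0..L} \<subseteq> S" "h 0 = x" "h L = y"
    using assms by (auto simp: joined_within_def)
  have "1-lipschitz_on {0..L} (\<lambda>u. h (L - u))"
  proof (rule lipschitz_onI)
    fix u v assume "u \<in> {0..L}" "v \<in> {0..L}"
    then show "dist (h (L - u)) (h (L - v)) \<le> 1 * dist u v"
      using lipschitz_onD[OF h(1), of "L - u" "L - v"] by (simp add: dist_real_def abs_minus_commute)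
  qed simp
  moreover have "(\<lambda>u. h (L - u)) ` {0..L} \<subseteq> S"
    using image_subset_iff[THEN iffD1, OF h(2)] by (simp add: image_subset_iff)
  ultimately show ?thesis
    unfolding joined_within_def using L h by (intro conjI exI[of _ "\<lambda>u. h (L - u)"]) auto
qed

text \<open>Waiting at \<open>y\<close> for the remaining time \<open>M - L\<close> is a 1-Lipschitz
  continuation.\<close>

lemma joined_within_le:
  assumes "joined_within S L x y" "L \<le> M"
  shows "joined_within S M x y"
proof -
  have "y \<in> S"
    using assms(1) by (auto simp: joined_within_def)
  then have "joined_within S (M - L) y y"
    using assms unfolding joined_within_def
    by (intro conjI exI[of _ "\<lambda>_. y"]) (auto intro: lipschitz_onI)
  from joined_within_trans[OF assms(1) this] show ?thesis
    by simp
qed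

lemma joined_within_convex:
  fixes x y :: "'a::real_normed_vector"
  assumes "convex S" "x \<in> S" "y \<in> S"
  shows "joined_within S (dist x y) x y"
proof (cases "x = y")
  case True
  then show ?thesis
    using assms by (auto simp: joined_within_def intro!: exI[of _ "\<lambda>_. y"])
next
  case False
  define e where "e = (y - x) /\<^sub>R dist x y"
  have ne: "norm e = 1"
    using False by (simp add: e_def dist_norm norm_minus_commute)
  have "1-lipschitz_on {0..dist x y} (\<lambda>u. x + u *\<^sub>R e)"
    by (intro lipschitz_onI) (auto simp: dist_norm ne simp flip: scaleR_left_diff_distrib)
  moreover have "(\<lambda>u. x + u *\<^sub>R e) ` {0..dist x y} \<subseteq> S"
  proof clarify
    fix u assume u: "u \<in> {0..dist x y}"
    have "x + u *\<^sub>R e = (1 - u / dist x y) *\<^sub>R x + (u / dist x y) *\<^sub>R y"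
      by (simp add: e_def algebra_simps divide_inverse)
    also have "\<dots> \<in> S"
      using u False assms by (intro convexD) auto
    finally show "x + u *\<^sub>R e \<in> S" .
  qed
  moreover have "x + dist x y *\<^sub>R e = y"
    using False by (simp add: e_def)
  ultimately show ?thesis
    unfolding joined_within_def by (intro conjI exI[of _ "\<lambda>u. x + u *\<^sub>R e"]) auto
qed

text \<open>The contraction halves distances, so the image curve may be run at double speed.\<close>

lemma joined_within_half_contraction:
  assumes "joined_within S L x y"
  shows "joined_within (half_contraction p ` S) (L / 2)
    (half_contraction p x) (half_contraction p y)"
proof -
  obtain h where L: "0 \<le> L" and h: "1-lipschitz_on {0..L} h" "h ` {0..L} \<subseteq> S" "h 0 = x" "h L = y"
    using assms by (auto simp: joined_within_def)
  have "1-lipschitz_on {0..L / 2} (\<lambda>u. half_contraction p (h (2 * u)))"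
  proof (rule lipschitz_onI)
    fix u v assume "u \<in> {0..L / 2}" "v \<in> {0..L / 2}"
    then have "dist (h (2 * u)) (h (2 * v)) \<le> 1 * dist (2 * u) (2 * v)"
      by (intro lipschitz_onD[OF h(1)]) auto
    moreover have "dist (2 * u) (2 * v) = 2 * dist u v"
      by (simp add: dist_real_def abs_if)
    ultimately have "dist (h (2 * u)) (h (2 * v)) \<le> 2 * dist u v"
      by simp
    then show "dist (half_contraction p (h (2 * u))) (half_contraction p (h (2 * v))) \<le> 1 * dist u v"
      by (simp add: half_contraction_def dist_norm flip: scaleR_diff_right)
  qed auto
  moreover have "(\<lambda>u. half_contraction p (h (2 * u))) ` {0..L / 2} \<subseteq> half_contraction p ` S"
    using image_subset_iff[THEN iffD1, OF h(2)] by (auto simp: image_subset_iff)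
  ultimately show ?thesis
    unfolding joined_within_def using L h
    by (intro conjI exI[of _ "\<lambda>u. half_contraction p (h (2 * u))"]) auto
qed

section \<open>Limits of curves in decreasing compact sets\<close>

text \<open>Along a subsequence the curves exist, are uniformly bounded by compactness of
  \<open>D 0\<close> and share one modulus of continuity, so Arzela-Ascoli gives a limit
  curve.\<close>

lemma joined_within_Inter:
  fixes D :: "nat \<Rightarrow> 'a::euclidean_space set"
  assumes compact: "\<And>n. compact (D n)" and dec: "decseq D"
    and as: "as \<longlonglongrightarrow> a" and bs: "bs \<longlonglongrightarrow> b"
    and freq: "\<exists>\<^sub>F n in sequentially. joined_within (D n) L (as n) (bs n)"
  shows "joined_within (\<Inter>n. D n) L a b"
proof -
  have L: "0 \<le> L"
    using frequently_ex[OF freq] by (auto simp: joined_within_def)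
  obtain r :: "nat \<Rightarrow> nat" where r: "strict_mono r"
    and "\<And>n. joined_within (D (r n)) L (as (r n)) (bs (r n))"
    using freq infinite_enumerate[of "{n. joined_within (D n) L (as n) (bs n)}"]
    by (auto simp: frequently_cofinite simp flip: cofinite_eq_sequentially)
  then obtain h where h: "\<And>n. 1-lipschitz_on {0..L} (h n)"
      "\<And>n. h n ` {0..L} \<subseteq> D (r n)" "\<And>n. h n 0 = as (r n)" "\<And>n. h n L = bs (r n)"
    unfolding joined_within_def by metis
  obtain M where M: "\<And>x. x \<in> D 0 \<Longrightarrow> norm x \<le> M"
    using compact_imp_bounded[OF compact] unfolding bounded_iff by metis
  have "norm (h n u) \<le> M" if "u \<in> {0..L}" for n u
    using M h(2)[of n] decseqD[OF dec, of 0 "r n"] that by blast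
  moreover have "\<exists>d. 0 < d \<and> (\<forall>n y. y \<in> {0..L} \<and> norm (x - y) < d \<longrightarrow> norm (h n x - h n y) < e)"
    if "x \<in> {0..L}" "0 < e" for x e
  proof (intro exI[of _ e] conjI allI impI)
    fix n y assume y: "y \<in> {0..L} \<and> norm (x - y) < e"
    then have "dist (h n x) (h n y) \<le> 1 * dist x y"
      using that by (intro lipschitz_onD[OF h(1)]) auto
    with y show "norm (h n x - h n y) < e"
      by (simp add: dist_norm)
  qed (rule that)
  ultimately obtain g k where k: "strict_mono (k :: nat \<Rightarrow> nat)"
    and unif: "\<And>e. 0 < e \<Longrightarrow> \<exists>N. \<forall>n x. n \<ge> N \<and> x \<in> {0..L} \<longrightarrow> norm (h (k n) x - g x) < e"
    by (rule Arzela_Ascoli[OF compact_Icc]) blast+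
  have lim: "(\<lambda>n. h (k n) x) \<longlonglongrightarrow> g x" if "x \<in> {0..L}" for x
    using unif that by (force simp: LIMSEQ_iff)
  have rk: "strict_mono (r \<circ> k)"
    using r k by (rule strict_mono_o)
  have "1-lipschitz_on {0..L} g"
  proof (rule lipschitz_onI)
    fix x y assume xy: "x \<in> {0..L}" "y \<in> {0..L}"
    show "dist (g x) (g y) \<le> 1 * dist x y"
      using lipschitz_onD[OF h(1) xy]
      by (intro LIMSEQ_le_const2[OF tendsto_dist[OF lim[OF xy(1)] lim[OF xy(2)]]]) auto
  qed simp
  moreover have "g x \<in> D m" if "x \<in> {0..L}" for x m
  proof (rule closed_sequentially[OF compact_imp_closed[OF compact]])
    \<comment> \<open>The shift by \<open>m\<close> makes the index \<open>r (k (n + m))\<close> at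
      least \<open>m\<close>, so every term already lies in the closed set
      \<open>D m\<close>.\<close>
    show "(\<lambda>n. h (k (n + m)) x) \<longlonglongrightarrow> g x"
      using lim[OF that] by (rule LIMSEQ_ignore_initial_segment)
    fix n
    have "m \<le> r (k (n + m))"
      using seq_suble[OF rk, of "n + m"] by simp
    then show "h (k (n + m)) x \<in> D m"
      using h(2)[of "k (n + m)"] decseqD[OF dec] that by blast
  qed
  moreover have "g 0 = a"
    using LIMSEQ_unique[OF lim[of 0] LIMSEQ_subseq_LIMSEQ[OF as rk, unfolded o_def, folded h(3)]] L
    by (simp add: h)
  moreover have "g L = b"
    using LIMSEQ_unique[OF lim[of L]] LIMSEQ_subseq_LIMSEQ[OF bs rk] L
    by (simp add: h o_def)
  ultimately show ?thesis
    unfolding joined_within_def using L by (intro conjI exI[of _ g]) auto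
qed

section \<open>The gasket as the intersection of its approximations\<close>

definition gasket_vertices :: "(real^2) set" where
  "gasket_vertices = {gasket_O1, gasket_O2, gasket_O3}"

lemma gasket_step_eq: "gasket_step A = (\<Union>p\<in>gasket_vertices. half_contraction p ` A)"
  by (auto simp: gasket_step_def gasket_vertices_def)

lemma half_contraction_image_subset_gasket_step:
  "p \<in> gasket_vertices \<Longrightarrow> half_contraction p ` A \<subseteq> gasket_step A"
  by (auto simp: gasket_step_eq)

lemma gasket_step_mono: "A \<subseteq> B \<Longrightarrow> gasket_step A \<subseteq> gasket_step B"
  by (auto simp: gasket_step_eq)

lemma half_contraction_eq: "half_contraction p x = (1/2) *\<^sub>R x + (1/2) *\<^sub>R p"
  by (simp add: half_contraction_def vec_eq_iff field_simps)

lemma half_contraction_self [simp]: "half_contraction p p = p"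
  by (simp add: half_contraction_def)

lemma half_contraction_commute: "half_contraction p q = half_contraction q p"
  by (simp add: half_contraction_eq)

lemma dist_half_contraction:
  "dist (half_contraction p x) (half_contraction p y) = dist x y / 2"
  by (simp add: half_contraction_def dist_norm flip: scaleR_diff_right)

lemma half_contraction_inject [simp]: "half_contraction p x = half_contraction p y \<longleftrightarrow> x = y"
  by (simp add: half_contraction_eq)

lemma cantor_approx_0: "cantor_approx 0 = convex hull gasket_vertices"
  by (simp add: gasket_vertices_def)

lemma vertex_in_cantor_approx: "p \<in> gasket_vertices \<Longrightarrow> p \<in> cantor_approx n"
proof (induction n)
  case 0
  then show ?case
    unfolding cantor_approx_0 by (rule hull_inc)
next
  case (Suc n)
  then have "half_contraction p p \<in> half_contraction p ` cantor_approx n"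
    by blast
  then show ?case
    using half_contraction_image_subset_gasket_step[OF Suc.prems] by auto
qed

lemma compact_gasket_step: "compact A \<Longrightarrow> compact (gasket_step A)"
  unfolding gasket_step_def half_contraction_def
  by (intro compact_Un compact_continuous_image continuous_intros)

lemma compact_cantor_approx: "compact (cantor_approx n)"
  by (induction n) (auto simp: compact_gasket_step finite_imp_compact_convex_hull)

lemma decseq_cantor_approx: "decseq cantor_approx"
proof (rule decseq_SucI)
  show "cantor_approx (Suc n) \<subseteq> cantor_approx n" for n
  proof (induction n)
    case 0
    have "half_contraction p x \<in> convex hull gasket_vertices"
      if "p \<in> gasket_vertices" "x \<in> convex hull gasket_vertices" for p x
      unfolding half_contraction_eq using that
      by (intro convexD[OF convex_convex_hull]) (auto intro: hull_inc)
    then show ?case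
      by (auto simp: cantor_approx_0 gasket_step_eq simp del: cantor_approx.simps(1))
  next
    case (Suc n)
    then show ?case
      by (simp add: gasket_step_mono)
  qed
qed

text \<open>Each contraction is injective, so a point outside the image of the intersection leaves
  the images of the approximations at a finite stage. The largest of the three stages serves all
  vertices at once.\<close>

lemma gasket_step_Inter_cantor_approx:
  "gasket_step (\<Inter>n. cantor_approx n) = (\<Inter>n. cantor_approx n)"
proof (intro equalityI subsetI)
  fix x assume "x \<in> gasket_step (\<Inter>n. cantor_approx n)"
  then have "x \<in> cantor_approx (Suc n)" for n
    using gasket_step_mono[of "\<Inter>n. cantor_approx n" "cantor_approx n"] by auto
  then show "x \<in> (\<Inter>n. cantor_approx n)"
    using decseq_SucD[OF decseq_cantor_approx] by blast
next
  fix x assume x: "x \<in> (\<Inter>n. cantor_approx n)"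
  show "x \<in> gasket_step (\<Inter>n. cantor_approx n)"
  proof (rule ccontr)
    assume notin: "x \<notin> gasket_step (\<Inter>n. cantor_approx n)"
    have "\<exists>n. x \<notin> half_contraction p ` cantor_approx n" if "p \<in> gasket_vertices" for p
    proof (rule ccontr)
      assume "\<not> ?thesis"
      then have all: "x \<in> half_contraction p ` cantor_approx n" for n
        by blast
      then obtain y where y: "x = half_contraction p y"
        by blast
      then have "y \<in> cantor_approx n" for n
        using all[of n] by auto
      with y that notin show False
        by (auto simp: gasket_step_eq)
    qed
    then obtain N where N: "x \<notin> half_contraction p ` cantor_approx (N p)"
      if "p \<in> gasket_vertices" for p
      by metis
    define M where "M = Max (N ` gasket_vertices)"
    have "x \<notin> half_contraction p ` cantor_approx M" if "p \<in> gasket_vertices" for p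
    proof -
      have "N p \<le> M"
        unfolding M_def using that by (intro Max_ge) (auto simp: gasket_vertices_def)
      then show ?thesis
        using N[OF that] decseqD[OF decseq_cantor_approx] by blast
    qed
    then have "x \<notin> cantor_approx (Suc M)"
      by (auto simp: gasket_step_eq)
    with x show False
      by blast
  qed
qed

text \<open>A point of \<open>A\<close> farthest from \<open>B\<close> is the contraction of a point
  of \<open>A\<close>, hence at most half the maximal distance away from \<open>B\<close>; so this
  maximum is 0.\<close>

lemma gasket_step_fixpoint_subset:
  assumes A: "compact A" "A = gasket_step A"
    and B: "compact B" "B \<noteq> {}" "B = gasket_step B"
  shows "A \<subseteq> B"
proof (cases "A = {}")
  case False
  have "continuous_on A (\<lambda>x. infdist x B)"
    by (intro continuous_intros)
  then obtain x where x: "x \<in> A" "\<And>y. y \<in> A \<Longrightarrow> infdist y B \<le> infdist x B"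
    using continuous_attains_sup[OF A(1) False] by metis
  obtain p y where p: "p \<in> gasket_vertices" and y: "y \<in> A" "x = half_contraction p y"
    using x(1) A(2) unfolding gasket_step_eq by blast
  obtain z where z: "z \<in> B" "infdist y B = dist y z"
    using infdist_attains_inf[OF compact_imp_closed[OF B(1)] B(2)] by metis
  have "half_contraction p z \<in> B"
    using p z B(3) unfolding gasket_step_eq by blast
  then have "infdist x B \<le> dist x (half_contraction p z)"
    by (rule infdist_le)
  also have "\<dots> = infdist y B / 2"
    by (simp add: y z dist_half_contraction)
  also have "\<dots> \<le> infdist x B / 2"
    using x y by simp
  finally have "infdist x B \<le> 0"
    by simp
  then have "infdist y B = 0" if "y \<in> A" for y
    using x(2)[OF that] infdist_nonneg[of y B] by linarith
  then show ?thesis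
    using in_closed_iff_infdist_zero[OF compact_imp_closed[OF B(1)] B(2)] by blast
qed simp

text \<open>Existence: the intersection is compact, fixed, and contains the vertices. Uniqueness:
  fixed points are included in each other both ways.\<close>

lemma sierpinski_gasket_eq: "sierpinski_gasket = (\<Inter>n. cantor_approx n)"
  unfolding sierpinski_gasket_def
proof (rule the_equality)
  let ?K = "\<Inter>n. cantor_approx n"
  have K: "compact ?K" "?K \<noteq> {}" "?K = gasket_step ?K"
    using vertex_in_cantor_approx[of gasket_O1]
    by (auto simp: gasket_step_Inter_cantor_approx gasket_vertices_def
        intro!: compact_Inter compact_cantor_approx)
  then show "?K \<noteq> {} \<and> compact ?K \<and> ?K = gasket_step ?K"
    by blast
  fix A assume "A \<noteq> {} \<and> compact A \<and> A = gasket_step A"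
  then have A: "compact A" "A \<noteq> {}" "A = gasket_step A"
    by blast+
  show "A = ?K"
    by (intro equalityI gasket_step_fixpoint_subset[OF A(1,3) K]
        gasket_step_fixpoint_subset[OF K(1,3) A])
qed

section \<open>Uniform quasiconvexity of the approximations\<close>

text \<open>The barycentric coordinate of \<open>x\<close> at the vertex \<open>p\<close> is \<open>1 - vertex_gap p x\<close>.\<close>
definition vertex_gap :: "real^2 \<Rightarrow> real^2 \<Rightarrow> real" where
  "vertex_gap p x = (2/3) * ((\<Sum>q\<in>gasket_vertices. p - q) \<bullet> (p - x))"

lemma gasket_vertices_distinct:
  "gasket_O1 \<noteq> gasket_O2" "gasket_O1 \<noteq> gasket_O3" "gasket_O2 \<noteq> gasket_O3"
  by (auto simp: gasket_O1_def gasket_O2_def gasket_O3_def vec_eq_iff forall_2)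

lemma sum_gasket_vertices:
  "(\<Sum>q\<in>gasket_vertices. f q) = f gasket_O1 + f gasket_O2 + f gasket_O3"
  using gasket_vertices_distinct by (simp add: gasket_vertices_def add.assoc)

lemma dist_gasket_vertices:
  assumes "p \<in> gasket_vertices" "q \<in> gasket_vertices" "p \<noteq> q"
  shows "dist p q = 1"
  using assms
  by (auto simp: gasket_vertices_def gasket_O1_def gasket_O2_def gasket_O3_def
      dist_norm norm_eq_1 inner_vec_def sum_2)

lemma vertex_gap_self [simp]: "vertex_gap p p = 0"
  by (simp add: vertex_gap_def)

text \<open>The two edges at \<open>p\<close> are unit vectors at 60 degrees, so their sum has inner
  product 1 + 1/2 with each; the factor 2/3 normalizes this to 1.\<close>

lemma vertex_gap_vertex:
  assumes "p \<in> gasket_vertices" "q \<in> gasket_vertices" "p \<noteq> q"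
  shows "vertex_gap p q = 1"
  using assms unfolding vertex_gap_def sum_gasket_vertices
  by (auto simp: gasket_vertices_def gasket_O1_def gasket_O2_def gasket_O3_def inner_vec_def sum_2)

lemma vertex_gap_convex_comb:
  assumes "u + v = 1"
  shows "vertex_gap p (u *\<^sub>R x + v *\<^sub>R y) = u * vertex_gap p x + v * vertex_gap p y"
proof -
  have "p - (u *\<^sub>R x + v *\<^sub>R y) = (u + v) *\<^sub>R p - (u *\<^sub>R x + v *\<^sub>R y)"
    using assms by simp
  also have "\<dots> = u *\<^sub>R (p - x) + v *\<^sub>R (p - y)"
    by (simp add: algebra_simps)
  finally show ?thesis
    unfolding vertex_gap_def by (simp only: inner_add_right inner_scaleR_right) (simp add: algebra_simps)
qed

lemma vertex_gap_half_contraction: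
  "vertex_gap p (half_contraction q x) = (vertex_gap p x + vertex_gap p q) / 2"
  by (simp add: half_contraction_eq vertex_gap_convex_comb)

text \<open>The three summands have norm at most 1, which gives the crude constant (2/3) * 3 = 2;
  the sharp one is 2 / sqrt 3, the inverse of the height.\<close>

lemma abs_vertex_gap_diff_le:
  assumes "p \<in> gasket_vertices"
  shows "\<bar>vertex_gap p x - vertex_gap p y\<bar> \<le> 2 * dist x y"
proof -
  let ?s = "\<Sum>q\<in>gasket_vertices. p - q"
  have "norm ?s \<le> (\<Sum>q\<in>gasket_vertices. dist p q)"
    unfolding dist_norm by (rule norm_sum)
  also have "\<dots> \<le> (\<Sum>q\<in>gasket_vertices. 1)"
  proof (rule sum_mono)
    show "dist p q \<le> 1" if "q \<in> gasket_vertices" for q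
      using dist_gasket_vertices[OF assms that] by (cases "p = q") auto
  qed
  also have "\<dots> = 3"
    unfolding sum_gasket_vertices by simp
  finally have "norm ?s \<le> 3" .
  have "vertex_gap p x - vertex_gap p y = (2/3) * (?s \<bullet> (y - x))"
    unfolding vertex_gap_def inner_diff_right by (simp only: right_diff_distrib)
  then have "\<bar>vertex_gap p x - vertex_gap p y\<bar> = (2/3) * \<bar>?s \<bullet> (y - x)\<bar>"
    by (simp only: abs_mult abs_numeral abs_divide)
  also have "\<dots> \<le> (2/3) * (norm ?s * dist y x)"
    unfolding dist_norm by (intro mult_left_mono Cauchy_Schwarz_ineq2) simp
  also have "\<dots> \<le> (2/3) * (3 * dist y x)"
    using \<open>norm ?s \<le> 3\<close> by (intro mult_left_mono mult_right_mono) auto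
  finally show ?thesis
    by (simp add: dist_commute)
qed

text \<open>The distance to \<open>p\<close> is convex and the gap is affine, so it suffices to
  compare them at the vertices, where they agree.\<close>

lemma dist_le_vertex_gap:
  assumes "p \<in> gasket_vertices" "x \<in> cantor_approx 0"
  shows "dist x p \<le> vertex_gap p x"
proof -
  have "convex {x. dist x p \<le> vertex_gap p x}"
  proof (rule convexI, clarify)
    fix x y :: "real^2" and u v :: real
    assume h: "dist x p \<le> vertex_gap p x" "dist y p \<le> vertex_gap p y"
      and uv: "0 \<le> u" "0 \<le> v" "u + v = 1"
    have "dist (u *\<^sub>R x + v *\<^sub>R y) p = norm (u *\<^sub>R (x - p) + v *\<^sub>R (y - p))"
      using uv(3) by (simp add: dist_norm algebra_simps flip: scaleR_add_left)
    also have "\<dots> \<le> u * dist x p + v * dist y p"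
      using norm_triangle_ineq[of "u *\<^sub>R (x - p)" "v *\<^sub>R (y - p)"] uv by (simp add: dist_norm)
    also have "\<dots> \<le> u * vertex_gap p x + v * vertex_gap p y"
      using h uv by (intro add_mono mult_left_mono) auto
    finally show "dist (u *\<^sub>R x + v *\<^sub>R y) p \<le> vertex_gap p (u *\<^sub>R x + v *\<^sub>R y)"
      by (simp add: vertex_gap_convex_comb[OF uv(3)])
  qed
  moreover have "dist q p \<le> vertex_gap p q" if "q \<in> gasket_vertices" for q
    using dist_gasket_vertices[OF assms(1) that] vertex_gap_vertex[OF assms(1) that]
    by (cases "p = q") (auto simp: dist_commute)
  ultimately show ?thesis
    using assms(2) hull_minimal[of gasket_vertices "{x. dist x p \<le> vertex_gap p x}" convex]
    unfolding cantor_approx_0 by blast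
qed

lemma vertex_gap_le_1:
  assumes "p \<in> gasket_vertices" "x \<in> cantor_approx n"
  shows "vertex_gap p x \<le> 1"
proof -
  have "convex {x. vertex_gap p x \<le> 1}"
    by (rule convexI) (simp add: vertex_gap_convex_comb convex_bound_le)
  moreover have "vertex_gap p q \<le> 1" if "q \<in> gasket_vertices" for q
    using vertex_gap_vertex[OF assms(1) that] by (cases "p = q") auto
  moreover have "x \<in> convex hull gasket_vertices"
    using assms(2) decseqD[OF decseq_cantor_approx, of 0 n] unfolding cantor_approx_0 by auto
  ultimately show ?thesis
    using hull_minimal[of gasket_vertices "{x. vertex_gap p x \<le> 1}" convex] by blast
qed

section \<open>Short curves inside the approximations\<close>

text \<open>The route first runs inside the cell of \<open>x\<close> to its corner towards
  \<open>p\<close>, then through the cell of \<open>p\<close>. The two bounds add up exactly to the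
  gap, so nothing is lost as \<open>n\<close> grows.\<close>

lemma joined_within_cantor_approx_vertex:
  assumes "p \<in> gasket_vertices" "x \<in> cantor_approx n"
  shows "joined_within (cantor_approx n) (vertex_gap p x) x p"
  using assms
proof (induction n arbitrary: p x)
  case 0
  have "joined_within (cantor_approx 0) (dist x p) x p"
    using 0 vertex_in_cantor_approx[of p 0] by (intro joined_within_convex) auto
  then show ?case
    using dist_le_vertex_gap[OF 0] by (rule joined_within_le)
next
  case (Suc n)
  have lift: "joined_within (cantor_approx (Suc n)) (vertex_gap r y / 2)
      (half_contraction q y) (half_contraction q r)"
    if "q \<in> gasket_vertices" "r \<in> gasket_vertices" "y \<in> cantor_approx n" for q r y
    using joined_within_mono[OF joined_within_half_contraction[OF Suc.IH[OF that(2,3)]]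
        half_contraction_image_subset_gasket_step[OF that(1)]] by simp
  obtain q z where q: "q \<in> gasket_vertices" and z: "z \<in> cantor_approx n" "x = half_contraction q z"
    using Suc.prems by (auto simp: gasket_step_eq)
  have xq: "joined_within (cantor_approx (Suc n)) (vertex_gap p z / 2) x (half_contraction q p)"
    using lift[OF q Suc.prems(1) z(1)] z(2) by simp
  show ?case
  proof (cases "q = p")
    case True
    then show ?thesis
      using xq z(2) by (simp add: vertex_gap_half_contraction)
  next
    case False
    \<comment> \<open>The corner \<open>half_contraction q p\<close> also belongs to the cell of
      \<open>p\<close>, as the image of the vertex \<open>q\<close>, whose gap 1 is halved
      there.\<close>
    have "joined_within (cantor_approx (Suc n)) (1 / 2) (half_contraction q p) p"
      using lift[OF Suc.prems(1,1) vertex_in_cantor_approx[OF q]] False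
      by (simp add: vertex_gap_vertex Suc.prems(1) q half_contraction_commute[of q])
    from joined_within_trans[OF xq this] show ?thesis
      using False q by (simp add: z(2) vertex_gap_half_contraction vertex_gap_vertex Suc.prems(1)
          add_divide_distrib)
  qed
qed

text \<open>The factor 4 is independent of \<open>n\<close>: within one cell the estimate is scale
  invariant, and across cells each of the two legs costs at most
  \<open>2 * dist x y\<close>.\<close>

lemma joined_within_cantor_approx:
  assumes "x \<in> cantor_approx n" "y \<in> cantor_approx n"
  shows "joined_within (cantor_approx n) (4 * dist x y) x y"
  using assms
proof (induction n arbitrary: x y)
  case 0
  have "joined_within (cantor_approx 0) (dist x y) x y"
    using 0 by (intro joined_within_convex) auto
  then show ?case
    by (rule joined_within_le) simp
next
  case (Suc n)
  obtain p v where p: "p \<in> gasket_vertices" and v: "v \<in> cantor_approx n" "x = half_contraction p v"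
    using Suc.prems(1) by (auto simp: gasket_step_eq)
  obtain q w where q: "q \<in> gasket_vertices" and w: "w \<in> cantor_approx n" "y = half_contraction q w"
    using Suc.prems(2) by (auto simp: gasket_step_eq)
  show ?case
  proof (cases "p = q")
    case True
    have "joined_within (cantor_approx (Suc n)) (4 * dist v w / 2) x y"
      using joined_within_mono[OF joined_within_half_contraction[OF Suc.IH[OF v(1) w(1)]]
          half_contraction_image_subset_gasket_step[OF p]] True v w by simp
    then show ?thesis
      using True v w by (simp add: dist_half_contraction)
  next
    case False
    let ?m = "half_contraction p q"
    have xm: "joined_within (cantor_approx (Suc n)) (vertex_gap q v / 2) x ?m"
      using joined_within_mono[OF joined_within_half_contraction[OF
          joined_within_cantor_approx_vertex[OF q v(1)]]
          half_contraction_image_subset_gasket_step[OF p]] v by simp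
    have "joined_within (cantor_approx (Suc n)) (vertex_gap p w / 2) y ?m"
      using joined_within_mono[OF joined_within_half_contraction[OF
          joined_within_cantor_approx_vertex[OF p w(1)]]
          half_contraction_image_subset_gasket_step[OF q]] w by (simp add: half_contraction_commute[of p])
    note joined_within_trans[OF xm joined_within_sym[OF this]]
    \<comment> \<open>The segment from \<open>x\<close> to \<open>y\<close> crosses the lines where the coordinates at \<open>p\<close> and at \<open>q\<close>
      equal 1/2, so it is at least as long as the gaps of \<open>x\<close> and \<open>y\<close> to these lines.\<close>
    moreover have "vertex_gap q v / 2 \<le> vertex_gap q x - vertex_gap q y"
      using False p q vertex_gap_le_1[OF q w(1)]
      by (simp add: v w vertex_gap_half_contraction vertex_gap_vertex add_divide_distrib)
    moreover have "vertex_gap p w / 2 \<le> vertex_gap p y - vertex_gap p x"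
      using False p q vertex_gap_le_1[OF p v(1)]
      by (simp add: v w vertex_gap_half_contraction vertex_gap_vertex add_divide_distrib)
    moreover note abs_vertex_gap_diff_le[OF p, of x y] abs_vertex_gap_diff_le[OF q, of x y]
    ultimately show ?thesis
      by (elim joined_within_le) linarith
  qed
qed

section \<open>Convergence of the intrinsic metrics\<close>

theorem theorem4p5:
  fixes a b :: "real^2" and as bs :: "nat \<Rightarrow> real^2"
  assumes "a \<in> sierpinski_gasket" and "b \<in> sierpinski_gasket"
    and "\<And>n. as n \<in> cantor_approx n" and "\<And>n. bs n \<in> cantor_approx n"
    and "as \<longlonglongrightarrow> a" and "bs \<longlonglongrightarrow> b"
  shows "(\<lambda>n. intrinsic_dist (cantor_approx n) (as n) (bs n))
           \<longlonglongrightarrow> intrinsic_dist sierpinski_gasket a b"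
proof (rule order_tendstoI)
  fix c assume c: "c < intrinsic_dist sierpinski_gasket a b"
  \<comment> \<open>A real \<open>L\<close> strictly in between turns distances at most
    \<open>c\<close> into curves on the common domain \<open>{0..L}\<close>, while the limit curve
    would contradict the second inequality.\<close>
  obtain L where L: "c < ennreal L" "ennreal L < intrinsic_dist sierpinski_gasket a b"
    using ennreal_rat_dense[OF c] by blast
  show "\<forall>\<^sub>F n in sequentially. c < intrinsic_dist (cantor_approx n) (as n) (bs n)"
  proof (rule ccontr)
    assume "\<not> ?thesis"
    then have "\<exists>\<^sub>F n in sequentially. intrinsic_dist (cantor_approx n) (as n) (bs n) \<le> c"
      by (simp add: not_eventually not_less)
    then have "\<exists>\<^sub>F n in sequentially. joined_within (cantor_approx n) L (as n) (bs n)"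
      by (rule frequently_elim1)
        (intro joined_within_if_intrinsic_dist_less order_le_less_trans[OF _ L(1)])
    with compact_cantor_approx decseq_cantor_approx assms(5,6)
    have "joined_within sierpinski_gasket L a b"
      unfolding sierpinski_gasket_eq by (rule joined_within_Inter)
    from intrinsic_dist_le[OF this] L(2) show False
      by simp
  qed
next
  fix c assume c: "intrinsic_dist sierpinski_gasket a b < c"
  obtain L where L: "intrinsic_dist sierpinski_gasket a b < ennreal L" "ennreal L < c"
    using ennreal_rat_dense[OF c] by blast
  have K: "sierpinski_gasket \<subseteq> cantor_approx n" for n
    by (auto simp: sierpinski_gasket_eq)
  \<comment> \<open>The route goes from \<open>as n\<close> to \<open>a\<close> in the
    approximation, from \<open>a\<close> to \<open>b\<close> in the gasket, which lies in every
    approximation, and then to \<open>bs n\<close>; the outer legs shrink to 0.\<close>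
  define M where "M n = 4 * dist (as n) a + L + 4 * dist b (bs n)" for n
  have le: "intrinsic_dist (cantor_approx n) (as n) (bs n) \<le> ennreal (M n)" for n
    unfolding M_def
    by (intro intrinsic_dist_le joined_within_trans[of _ _ _ a] joined_within_trans[of _ _ _ b]
        joined_within_cantor_approx assms joined_within_mono[OF _ K]
        joined_within_if_intrinsic_dist_less[OF L(1)] subsetD[OF K])
  have "M \<longlonglongrightarrow> 4 * dist a a + L + 4 * dist b b"
    unfolding M_def by (intro tendsto_intros assms)
  then have "(\<lambda>n. ennreal (M n)) \<longlonglongrightarrow> ennreal L"
    by (intro tendsto_ennrealI) simp
  then have "\<forall>\<^sub>F n in sequentially. ennreal (M n) < c"
    using L(2) by (rule order_tendstoD)
  then show "\<forall>\<^sub>F n in sequentially. intrinsic_dist (cantor_approx n) (as n) (bs n) < c"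
    by eventually_elim (rule order_le_less_trans[OF le])
qed

end
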